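(* For each integer $n\ge 3$ let $$E_n=\left\{\tfrac12,1,\tfrac32,\tfrac94\right\}\cup\left\{9,-2,(-2)^2,(-2)^3,\dots,(-2)^n\right\},$$ and let $E=\bigcup_{n=3}^{\infty}E_n$. Then there is an arithmetic map $\sigma:E\to\mathbb{Q}(\sqrt{33})$ which moves $9$ and all the numbers $(-2)^k$ with $k\in\{1,2,3,\dots\}$, i.e. $\sigma(9)\neq 9$ and $\sigma((-2)^k)\ne(-2)^k$ for every $k\ge1$. Moreover, for each integer $n\ge3$ and each $r\in E_n\setminus\{\tfrac12,1,\tfrac32,\tfrac94\}$: (i) $E_n$ is an arithmetic neighbourhood of $r$ inside $\mathbb{Q}$; (ii) $E_n$ is not an arithmetic neighbourhood of $r$ inside $\mathbb{Q}(\sqrt{33})$.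
   Context: Let $K$ be a ring (with $1$) and $A\subseteq K$. A map $f:A\to K$ is called arithmetic if: (1) if $1\in A$ then $f(1)=1$; (2) if $a,b\in A$ and $a+b\in A$ then $f(a+b)=f(a)+f(b)$; (3) if $a,b\in A$ and $a\cdot b\in A$ then $f(a\cdot b)=f(a)\cdot f(b)$. (In (2) and (3), $a=b$ is allowed.) A finite set $A\subseteq K$ with $r\in A$ is an arithmetic neighbourhood of $r$ inside $K$ if every arithmetic map $f:A\to K$ satisfies $f(r)=r$. *)

theory Defs
  imports Complex_Main "HOL-Library.FuncSet"
begin

text \<open>
  A ring \<open>K\<close> is represented by its carrier, a subring of an ambient type of class \<open>ring_1\<close>
  (the whole type being \<open>K = UNIV\<close>). Maps defined on \<open>A\<close> are total functions of which only the
  values on \<open>A\<close> are relevant.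
\<close>

definition arithmetic_map :: "'a::ring_1 set \<Rightarrow> 'a set \<Rightarrow> ('a \<Rightarrow> 'a) \<Rightarrow> bool" where
  "arithmetic_map K A f \<longleftrightarrow>
     A \<subseteq> K \<and> f \<in> A \<rightarrow> K \<and>
     (1 \<in> A \<longrightarrow> f 1 = 1) \<and>
     (\<forall>a\<in>A. \<forall>b\<in>A. a + b \<in> A \<longrightarrow> f (a + b) = f a + f b) \<and>
     (\<forall>a\<in>A. \<forall>b\<in>A. a * b \<in> A \<longrightarrow> f (a * b) = f a * f b)"

definition arithmetic_neighbourhood :: "'a::ring_1 set \<Rightarrow> 'a set \<Rightarrow> 'a \<Rightarrow> bool" where
  "arithmetic_neighbourhood K A r \<longleftrightarrow>
     finite A \<and> A \<subseteq> K \<and> r \<in> A \<and> (\<forall>f. arithmetic_map K A f \<longrightarrow> f r = r)"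

definition is_subfield :: "'a::field set \<Rightarrow> bool" where
  "is_subfield F \<longleftrightarrow>
     0 \<in> F \<and> 1 \<in> F \<and>
     (\<forall>x\<in>F. \<forall>y\<in>F. x + y \<in> F \<and> x * y \<in> F) \<and>
     (\<forall>x\<in>F. - x \<in> F \<and> inverse x \<in> F)"

text \<open>The field extension of \<open>F\<close> generated by \<open>S\<close> inside the ambient field.\<close>

definition field_adjoin :: "'a::field set \<Rightarrow> 'a set \<Rightarrow> 'a set" where
  "field_adjoin F S = is_subfield hull (F \<union> S)"

definition Q_sqrt33 :: "real set" where
  "Q_sqrt33 = field_adjoin \<rat> {sqrt 33}"

definition E_n :: "nat \<Rightarrow> real set" where
  "E_n n = {1/2, 1, 3/2, 9/4} \<union> ({9} \<union> {(-2) ^ k | k. 1 \<le> k \<and> k \<le> n})"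

definition E_all :: "real set" where
  "E_all = (\<Union>n\<in>{3..}. E_n n)"

lemma is_subfield_Rats: "is_subfield (\<rat> :: real set)"
  by (simp add: is_subfield_def)

lemma is_subfield_field_adjoin: "is_subfield (field_adjoin F S)"
  unfolding field_adjoin_def
  by (rule hull_in) (simp add: is_subfield_def)

lemma is_subfield_Q_sqrt33: "is_subfield Q_sqrt33"
  by (simp add: Q_sqrt33_def is_subfield_field_adjoin)

lemma Q_sqrt33_eq: "Q_sqrt33 = {a + b * sqrt 33 | a b. a \<in> \<rat> \<and> b \<in> \<rat>}"
  (is "_ = ?R")
proof
  have mem: "a + b * sqrt 33 \<in> ?R" if "a \<in> \<rat>" "b \<in> \<rat>" for a b
    using that by blast
  have rat: "a \<in> ?R" if "a \<in> \<rat>" for a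
    using mem[OF that Rats_0] by simp
  have inv: "inverse (a + b * sqrt 33) \<in> ?R" if ab: "a \<in> \<rat>" "b \<in> \<rat>" for a b
  proof (cases "a - b * sqrt 33 = 0")
    case True
    have "a + b * sqrt 33 \<in> \<rat>"
      using True ab by (metis Rats_add eq_iff_diff_eq_0)
    then show ?thesis by (intro rat Rats_inverse)
  next
    case False
    define N where "N = a * a - 33 * (b * b)"
    have "N = (a - b * sqrt 33) * (a + b * sqrt 33)"
      by (simp add: N_def algebra_simps)
    then have "inverse (a + b * sqrt 33) = (a - b * sqrt 33) / N"
      using nonzero_mult_divide_mult_cancel_left[OF False, of 1 "a + b * sqrt 33"]
      by (simp only: mult_1_right inverse_eq_divide)
    also have "\<dots> = a / N + (- b / N) * sqrt 33"
      by (simp add: diff_divide_distrib)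
    also have "\<dots> \<in> ?R"
      by (intro mem) (simp_all add: N_def ab)
    finally show ?thesis .
  qed
  have "is_subfield ?R"
    unfolding is_subfield_def
  proof (intro conjI ballI)
    show "0 \<in> ?R" "1 \<in> ?R" by (rule rat; simp)+
  next
    fix x y assume "x \<in> ?R" "y \<in> ?R"
    then obtain a b c d where *: "a \<in> \<rat>" "b \<in> \<rat>" "c \<in> \<rat>" "d \<in> \<rat>"
      and xy: "x = a + b * sqrt 33" "y = c + d * sqrt 33" by blast
    have "x + y = (a + c) + (b + d) * sqrt 33"
      by (simp add: xy algebra_simps)
    also have "\<dots> \<in> ?R" using * by (intro mem Rats_add)
    finally show "x + y \<in> ?R" .
    have "x * y = (a * c + 33 * (b * d)) + (a * d + b * c) * sqrt 33"
      by (simp add: xy algebra_simps)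
    also have "\<dots> \<in> ?R" using * by (intro mem Rats_add Rats_mult) simp_all
    finally show "x * y \<in> ?R" .
  next
    fix x assume "x \<in> ?R"
    then obtain a b where *: "a \<in> \<rat>" "b \<in> \<rat>" and x: "x = a + b * sqrt 33" by blast
    have "- x = (- a) + (- b) * sqrt 33" by (simp add: x)
    also have "\<dots> \<in> ?R" using * by (intro mem) simp_all
    finally show "- x \<in> ?R" .
    show "inverse x \<in> ?R" unfolding x by (rule inv) (use * in auto)
  qed
  moreover have "\<rat> \<union> {sqrt 33} \<subseteq> ?R"
    using rat mem[OF Rats_0 Rats_1] by auto
  ultimately show "Q_sqrt33 \<subseteq> ?R"
    unfolding Q_sqrt33_def field_adjoin_def by (intro hull_minimal)
next
  have "\<rat> \<union> {sqrt 33} \<subseteq> Q_sqrt33"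
    unfolding Q_sqrt33_def field_adjoin_def by (rule hull_subset)
  then show "?R \<subseteq> Q_sqrt33"
    using is_subfield_Q_sqrt33 unfolding is_subfield_def by blast
qed

end

theory Submission
  imports Defs
begin

text \<open>
  Let \<open>f\<close> be arithmetic on \<open>E_n\<close> and put \<open>x = f (-2)\<close>. The relations \<open>1/2 + 1/2 = 1\<close>,
  \<open>1/2 + 1 = 3/2\<close> and \<open>3/2 * 3/2 = 9/4\<close> force \<open>f (9/4) = 9/4\<close>; multiplicativity gives
  \<open>f ((-2)^k) = x^k\<close>, and \<open>9/4 * 4 = 9\<close> gives \<open>f 9 = 9/4 x\<^sup>2\<close>. Finally \<open>9 + (-8) = 1\<close> turns into
  \<open>x\<^sup>3 + 9/4 x\<^sup>2 = 1\<close>, that is \<open>(x + 2) (4 x\<^sup>2 + x - 2) = 0\<close>. The quadratic factor has discriminant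
  \<open>33\<close>, which is not a rational square. Hence over \<open>\<rat>\<close> the only choice is \<open>x = -2\<close>, and then \<open>f\<close>
  fixes \<open>9\<close> and all the powers (\<open>arithmetic_neighbourhood_Rats\<close>).

  Over \<open>\<rat>(\<surd>33)\<close> there is the further root \<open>x = (\<surd>33 - 1) / 8\<close>, strictly between \<open>0\<close> and \<open>1\<close>.
  Sending \<open>(-2)^k\<close> to \<open>x^k\<close>, \<open>9\<close> to \<open>9/4 x\<^sup>2\<close> and fixing the remaining elements defines a map on all
  of \<open>E\<close> that moves \<open>9\<close> and every \<open>(-2)^k\<close> with \<open>k \<ge> 1\<close>, and its restrictions refute the
  neighbourhood property for every \<open>E_n\<close>. That it is arithmetic
  (\<open>arithmetic_map_replace_neg2\<close>) rests on the fact that \<open>E\<close> has no additive or multiplicative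
  relations other than those listed above, the products of two powers of \<open>-2\<close>, and the trivial
  products by \<open>1\<close> (\<open>E_all_sums\<close> and \<open>E_all_products\<close>). After multiplication by \<open>4\<close> this is a
  question about integers. There the powers of \<open>-2\<close> become \<open>4, -8, 16, -32, \<dots>\<close>, which are all \<open>1\<close>
  modulo \<open>3\<close> and, except for the first two, divisible by \<open>16\<close>; these congruences leave only
  finitely many candidates for a relation.
\<close>

section \<open>Sums and products inside the set\<close>

definition neg2_powers :: "real set" where
  "neg2_powers = range (\<lambda>k. (-2) ^ k)"

text \<open>
  The congruences satisfied by the integers \<open>4 (-2)^k\<close>: a necessary condition, not a
  characterisation, which is all that is used to exclude relations.
\<close>

definition power_like :: "int \<Rightarrow> bool" where
  "power_like C \<longleftrightarrow> C mod 3 = 1 \<and> (C = 4 \<or> C = -8 \<or> 16 dvd C)"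

lemma power_like_neg2_power: "power_like (4 * (-2) ^ k)"
proof (induction k)
  case 0
  show ?case by (simp add: power_like_def)
next
  case (Suc k)
  have "power_like (-2 * C)" if "power_like C" for C
  proof -
    have "(-2 * C) mod 3 = 1" if "C mod 3 = 1" using that by presburger
    moreover have "-2 * C = 4 \<or> -2 * C = -8 \<or> 16 dvd -2 * C" if "C = 4 \<or> C = -8 \<or> 16 dvd C"
      using that by (elim disjE) simp_all
    ultimately show ?thesis using that unfolding power_like_def by blast
  qed
  from this[OF Suc] show ?case by (simp add: ac_simps)
qed

text \<open>
  The element \<open>1\<close> is absorbed into the powers as \<open>(-2)^0\<close>, which removes it as a special case.
\<close>

lemma E_all_eq: "E_all = {1/2, 3/2, 9/4, 9} \<union> neg2_powers"
proof (intro equalityI subsetI)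
  fix r assume "r \<in> E_all"
  moreover have "(1::real) = (-2) ^ 0" by simp
  ultimately show "r \<in> {1/2, 3/2, 9/4, 9} \<union> neg2_powers"
    unfolding E_all_def E_n_def neg2_powers_def by blast
next
  fix r :: real assume "r \<in> {1/2, 3/2, 9/4, 9} \<union> neg2_powers"
  moreover have "(-2) ^ k \<in> E_all" for k
  proof (cases "k = 0")
    case False
    then have "(-2) ^ k \<in> E_n (max 3 k)"
      unfolding E_n_def by force
    then show ?thesis unfolding E_all_def by force
  qed (auto simp: E_all_def E_n_def)
  ultimately show "r \<in> E_all"
    unfolding E_all_def E_n_def neg2_powers_def by auto
qed

text \<open>
  The factor \<open>4\<close> clears all denominators: the four elements that are not powers become
  \<open>2, 6, 9, 36\<close>.
\<close>

lemma E_all_scaled: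
  assumes "r \<in> E_all"
  obtains C :: int where "r = of_int C / 4"
    "C \<in> {2, 6, 9, 36} \<or> r \<in> neg2_powers \<and> power_like C"
proof -
  consider "r \<in> {1/2, 3/2, 9/4, 9}" | k where "r = (-2) ^ k"
    using assms unfolding E_all_eq neg2_powers_def by blast
  then show thesis
  proof cases
    case 1
    then show thesis
      using that[of 2] that[of 6] that[of 9] that[of 36] by auto
  next
    case 2
    then have "r = of_int (4 * (-2) ^ k) / 4" by simp
    moreover have "r \<in> neg2_powers" using 2 by (simp add: neg2_powers_def)
    ultimately show thesis
      using that power_like_neg2_power by blast
  qed
qed

text \<open>
  Modulo \<open>3\<close> the sum is \<open>2\<close>, whereas a power-like number is \<open>1\<close> and \<open>6, 9, 36\<close> are \<open>0\<close>. The
  remaining value \<open>2\<close> is excluded because the sum is divisible by \<open>4\<close>.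
\<close>

lemma power_like_sum:
  assumes "power_like A" "power_like B"
  shows "A + B \<notin> {2, 6, 9, 36}" "\<not> power_like (A + B)"
proof -
  have "A mod 3 = 1" "B mod 3 = 1" using assms by (simp_all add: power_like_def)
  then have mod3: "(A + B) mod 3 = 2" by presburger
  have "4 dvd A" "4 dvd B"
    using assms by (auto simp: power_like_def elim: dvd_trans[rotated])
  then have "4 dvd A + B" by simp
  with mod3 show "A + B \<notin> {2, 6, 9, 36}" "\<not> power_like (A + B)"
    by (auto simp: power_like_def)
qed

text \<open>
  The split used for sums and products: a scaled element is one of six explicit numbers or a
  nonzero multiple of \<open>16\<close>. Zero is excluded because it is \<open>0\<close> modulo \<open>3\<close>.
\<close>

lemma power_like_cases:
  assumes "C \<in> {2, 6, 9, 36} \<or> power_like C"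
  obtains "C \<in> {2, 6, 9, 36, 4, -8}" | "16 dvd C" "C \<noteq> 0"
  using assms unfolding power_like_def by fastforce

text \<open>
  If at most one of \<open>P\<close>, \<open>Q\<close>, \<open>P + Q\<close> is a multiple of \<open>16\<close>, the other two determine it, and only
  finitely many numbers have to be inspected. If \<open>Q\<close> and \<open>P + Q\<close> both are, so is \<open>P\<close>, which is
  not the case.
\<close>

lemma scaled_sum:
  assumes P: "P \<in> {2, 6, 9, 36}"
    and Q: "Q \<in> {2, 6, 9, 36} \<or> power_like Q"
    and PQ: "P + Q \<in> {2, 6, 9, 36} \<or> power_like (P + Q)"
  shows "(P, Q) \<in> {(2, 2), (2, 4), (36, -32)}"
proof -
  define C where "C = P + Q"
  have C: "C \<in> {2, 6, 9, 36} \<or> power_like C" using PQ by (simp add: C_def)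
  have Q_eq: "Q = C - P" by (simp add: C_def)
  from C show ?thesis
  proof (cases rule: power_like_cases)
    case C: 1
    from Q show ?thesis
    proof (cases rule: power_like_cases)
      case 1
      with P C show ?thesis unfolding C_def by auto
    next
      case 2
      with P C show ?thesis unfolding Q_eq by auto
    qed
  next
    case C: 2
    from Q show ?thesis
    proof (cases rule: power_like_cases)
      case 1
      with P C show ?thesis unfolding C_def by auto
    next
      case 2
      with C(1) have "16 dvd P" unfolding C_def using dvd_add_left_iff by blast
      with P show ?thesis by auto
    qed
  qed
qed

text \<open>
  The equation \<open>P * Q = 4 * C\<close> is \<open>(P/4) (Q/4) = C/4\<close>, a product inside the unscaled set. If \<open>Q\<close>
  and \<open>C\<close> are both power-like, it reads \<open>P = 1\<close> modulo \<open>3\<close>, which is false for all four values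
  of \<open>P\<close>. In the other cases, \<open>Q\<close> or \<open>C\<close> is explicit, and divisibility by powers of two leaves
  finitely many numbers.
\<close>

lemma scaled_product:
  assumes P: "P \<in> {2, 6, 9, 36}"
    and Q: "Q \<in> {2, 6, 9, 36} \<or> power_like Q"
    and C: "C \<in> {2, 6, 9, 36} \<or> power_like C"
    and PQ: "P * Q = 4 * C"
  shows "Q = 4 \<or> (P, Q) \<in> {(6, 6), (9, 16)}"
proof -
  consider "Q \<in> {2, 6, 9, 36}" | "power_like Q" "C \<in> {2, 6, 9, 36}" | "power_like Q" "power_like C"
    using Q C by blast
  then show ?thesis
  proof cases
    case 1
    from C have "4 * C \<in> {8, 24, 36, 144, 16, -32} \<or> 64 dvd 4 * C"
      by (cases rule: power_like_cases) auto
    with 1 P show ?thesis unfolding PQ[symmetric] by auto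
  next
    case 2
    from Q have "Q \<in> {2, 6, 9, 36, 4, -8} \<or> 16 dvd Q"
      by (cases rule: power_like_cases) auto
    then show ?thesis
    proof
      assume "Q \<in> {2, 6, 9, 36, 4, -8}"
      with 2(2) P PQ show ?thesis by auto
    next
      assume Q16: "16 dvd Q"
      \<comment> \<open>Of \<open>8, 24, 36, 144\<close> only \<open>144 = 4 * 36\<close> is a multiple of \<open>16\<close>.\<close>
      then have "16 dvd 4 * C" unfolding PQ[symmetric] by simp
      with 2(2) have "C = 36" by auto
      with P PQ Q16 show ?thesis by auto
    qed
  next
    case 3
    then have "Q mod 3 = 1" "C mod 3 = 1" by (simp_all add: power_like_def)
    then have "(4 * C) mod 3 = 1" "(P * Q) mod 3 = P mod 3"
      using mod_mult_right_eq[of 4 C 3] mod_mult_right_eq[of P Q 3] by simp_all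
    with P PQ show ?thesis by auto
  qed
qed

lemma E_all_sums:
  assumes "a \<in> E_all" "b \<in> E_all" "a + b \<in> E_all"
  shows "(a, b) \<in> {(1/2, 1/2), (1/2, 1), (1, 1/2), (9, -8), (-8, 9)}"
proof -
  obtain A where A: "a = of_int A / 4" "A \<in> {2, 6, 9, 36} \<or> a \<in> neg2_powers \<and> power_like A"
    using assms(1) by (rule E_all_scaled)
  obtain B where B: "b = of_int B / 4" "B \<in> {2, 6, 9, 36} \<or> b \<in> neg2_powers \<and> power_like B"
    using assms(2) by (rule E_all_scaled)
  obtain C where C: "a + b = of_int C / 4"
    "C \<in> {2, 6, 9, 36} \<or> a + b \<in> neg2_powers \<and> power_like C"
    using assms(3) by (rule E_all_scaled)
  have "(of_int (A + B) :: real) = of_int C"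
    using A(1) B(1) C(1) by simp
  then have "A + B = C" by (simp only: of_int_eq_iff)
  with C(2) have AB: "A + B \<in> {2, 6, 9, 36} \<or> power_like (A + B)" by metis
  then consider "A \<in> {2, 6, 9, 36}" | "B \<in> {2, 6, 9, 36}"
    using A(2) B(2) power_like_sum by blast
  then have "(A, B) \<in> {(2, 2), (2, 4), (4, 2), (36, -32), (-32, 36)}"
  proof cases
    case 1
    then show ?thesis using scaled_sum[of A B] AB B(2) by blast
  next
    case 2
    then have "(B, A) \<in> {(2, 2), (2, 4), (36, -32)}"
      using scaled_sum[of B A] AB A(2) by (metis add.commute)
    then show ?thesis by auto
  qed
  then show ?thesis using A(1) B(1) by auto
qed

lemma E_all_products:
  assumes "a \<in> E_all" "b \<in> E_all" "a * b \<in> E_all"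
  shows "a = 1 \<or> b = 1 \<or> (a, b) \<in> {(3/2, 3/2), (4, 9/4), (9/4, 4)} \<or>
    a \<in> neg2_powers \<and> b \<in> neg2_powers"
proof -
  obtain A where A: "a = of_int A / 4" "A \<in> {2, 6, 9, 36} \<or> a \<in> neg2_powers \<and> power_like A"
    using assms(1) by (rule E_all_scaled)
  obtain B where B: "b = of_int B / 4" "B \<in> {2, 6, 9, 36} \<or> b \<in> neg2_powers \<and> power_like B"
    using assms(2) by (rule E_all_scaled)
  obtain C where C: "a * b = of_int C / 4"
    "C \<in> {2, 6, 9, 36} \<or> a * b \<in> neg2_powers \<and> power_like C"
    using assms(3) by (rule E_all_scaled)
  have "(of_int (A * B) :: real) = of_int (4 * C)"
    using C(1) unfolding A(1) B(1) by simp
  then have AB: "A * B = 4 * C" by (simp only: of_int_eq_iff)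
  consider "A \<in> {2, 6, 9, 36}" | "B \<in> {2, 6, 9, 36}"
    | "a \<in> neg2_powers" "b \<in> neg2_powers"
    using A(2) B(2) by blast
  then show ?thesis
  proof cases
    case 1
    then have "B = 4 \<or> (A, B) \<in> {(6, 6), (9, 16)}"
      using scaled_product[of A B C] B(2) C(2) AB by blast
    then show ?thesis using A(1) B(1) by auto
  next
    case 2
    then have "A = 4 \<or> (B, A) \<in> {(6, 6), (9, 16)}"
      using scaled_product[of B A C] A(2) C(2) AB by (metis mult.commute)
    then show ?thesis using A(1) B(1) by auto
  qed blast
qed

section \<open>The arithmetic map attached to a root of the cubic\<close>

text \<open>
  The map with \<open>-2 \<mapsto> x\<close> that the multiplicative relations dictate. The inverse of the injection
  \<open>k \<mapsto> (-2)^k\<close> recovers the exponent of a power of \<open>-2\<close>.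
\<close>

definition replace_neg2 :: "real \<Rightarrow> real \<Rightarrow> real" where
  "replace_neg2 x r =
     (if r = 9 then 9/4 * x\<^sup>2
      else if r \<in> neg2_powers then x ^ inv (\<lambda>k. (-2) ^ k) r
      else r)"

text \<open>
  The branch for \<open>9\<close> in the definition does not interfere: \<open>36\<close> is \<open>0\<close> modulo \<open>3\<close>, so \<open>9\<close> is not a
  power of \<open>-2\<close>.
\<close>

lemma replace_neg2_power: "replace_neg2 x ((-2) ^ k) = x ^ k"
proof -
  have inj: "inj (\<lambda>k. (-2 :: real) ^ k)"
  proof (rule injI)
    fix i j :: nat assume "(-2 :: real) ^ i = (-2) ^ j"
    then have "\<bar>(-2 :: real) ^ i\<bar> = \<bar>(-2) ^ j\<bar>" by simp
    then show "i = j" by (simp add: power_abs)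
  qed
  have "(of_int (4 * (-2) ^ k) :: real) \<noteq> of_int 36"
    unfolding of_int_eq_iff using power_like_neg2_power[of k] by (auto simp: power_like_def)
  then have "(-2 :: real) ^ k \<noteq> 9" by simp
  then show ?thesis
    using inv_f_f[OF inj, of k] by (simp add: replace_neg2_def neg2_powers_def)
qed

lemma replace_neg2_fixed:
  assumes "r \<in> {1/2, 3/2, 9/4}"
  shows "replace_neg2 x r = r"
proof -
  have "r \<noteq> (-2) ^ k" for k
  proof
    assume "r = (-2) ^ k"
    then have "(of_int (4 * (-2) ^ k) :: real) = 4 * r" by simp
    with assms have "(of_int (4 * (-2) ^ k) :: real) \<in> {of_int 2, of_int 6, of_int 9}"
      by auto
    then have "4 * (-2 :: int) ^ k \<in> {2, 6, 9}"
      unfolding insert_iff of_int_eq_iff by blast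
    moreover have "\<not> power_like C" if "C \<in> {2, 6, 9}" for C
      using that by (auto simp: power_like_def)
    ultimately show False using power_like_neg2_power by blast
  qed
  then show ?thesis using assms by (auto simp: replace_neg2_def neg2_powers_def)
qed

lemma replace_neg2_simps [simp]:
  "replace_neg2 x 1 = 1" "replace_neg2 x 4 = x\<^sup>2" "replace_neg2 x (-8) = x ^ 3"
  "replace_neg2 x 9 = 9/4 * x\<^sup>2"
  "replace_neg2 x (1/2) = 1/2" "replace_neg2 x (3/2) = 3/2" "replace_neg2 x (9/4) = 9/4"
  using replace_neg2_power[of x 0] replace_neg2_power[of x 2] replace_neg2_power[of x 3]
  by (simp_all add: replace_neg2_fixed) (simp add: replace_neg2_def)

lemma Rats_subset_subfield:
  assumes "is_subfield (F :: real set)"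
  shows "\<rat> \<subseteq> F"
proof -
  have nat: "of_nat n \<in> F" for n
    using assms by (induction n) (auto simp: is_subfield_def)
  have int: "of_int z \<in> F" for z
    using assms nat by (cases z rule: int_cases2) (auto simp: is_subfield_def)
  show ?thesis
  proof
    fix r :: real assume "r \<in> \<rat>"
    then obtain a b :: int where "r = of_int a / of_int b" by (auto elim: Rats_cases')
    then show "r \<in> F" using assms int by (simp add: is_subfield_def divide_inverse)
  qed
qed

lemma power_mem_subfield: "is_subfield F \<Longrightarrow> x \<in> F \<Longrightarrow> x ^ n \<in> F"
  by (induction n) (auto simp: is_subfield_def)

lemma E_all_subset_Rats: "E_all \<subseteq> \<rat>"
  unfolding E_all_eq neg2_powers_def by auto

text \<open>
  Every relation of \<open>E\<close> holds for the images identically in \<open>x\<close>, except \<open>9 + (-8) = 1\<close> and its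
  mirror image, which become the cubic equation.
\<close>

lemma arithmetic_map_replace_neg2:
  assumes F: "is_subfield F" "x \<in> F"
  assumes x: "x ^ 3 + 9/4 * x\<^sup>2 = 1"
  shows "arithmetic_map F E_all (replace_neg2 x)"
  unfolding arithmetic_map_def
proof (intro conjI ballI impI)
  have "\<rat> \<subseteq> F" using F(1) by (rule Rats_subset_subfield)
  then show sub: "E_all \<subseteq> F" using E_all_subset_Rats by blast
  show "replace_neg2 x \<in> E_all \<rightarrow> F"
  proof
    fix r assume r: "r \<in> E_all"
    then consider "r \<in> {1/2, 3/2, 9/4}" | "r = 9" | k where "r = (-2) ^ k"
      unfolding E_all_eq neg2_powers_def by blast
    then show "replace_neg2 x r \<in> F"
    proof cases
      case 1
      show ?thesis unfolding replace_neg2_fixed[OF 1] using sub r by blast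
    next
      case 2
      have "9/4 \<in> F" using sub by (simp add: E_all_eq)
      then have "9/4 * x\<^sup>2 \<in> F"
        using F(1) power_mem_subfield[OF F, of 2] unfolding is_subfield_def by blast
      then show ?thesis using 2 by simp
    next
      case 3
      then show ?thesis by (simp add: replace_neg2_power power_mem_subfield[OF F])
    qed
  qed
  show "replace_neg2 x 1 = 1" by simp
next
  fix a b assume ab: "a \<in> E_all" "b \<in> E_all" "a + b \<in> E_all"
  have "x ^ 3 = 1 - 9/4 * x\<^sup>2" using x by simp
  with E_all_sums[OF ab] show "replace_neg2 x (a + b) = replace_neg2 x a + replace_neg2 x b"
    unfolding insert_iff prod.inject empty_iff
    by (elim disjE conjE FalseE; hypsubst; simp)
next
  fix a b assume "a \<in> E_all" "b \<in> E_all" "a * b \<in> E_all"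
  from E_all_products[OF this] show "replace_neg2 x (a * b) = replace_neg2 x a * replace_neg2 x b"
    unfolding neg2_powers_def insert_iff prod.inject empty_iff
  proof (elim disjE conjE rangeE FalseE)
    fix i j :: nat assume "a = (-2) ^ i" "b = (-2) ^ j"
    then show ?thesis by (simp only: replace_neg2_power flip: power_add)
  qed (hypsubst, simp add: power2_eq_square)+
qed

lemma arithmetic_map_subset:
  "arithmetic_map K B f \<Longrightarrow> A \<subseteq> B \<Longrightarrow> arithmetic_map K A f"
  unfolding arithmetic_map_def by blast

section \<open>Rational rigidity\<close>

text \<open>
  In lowest terms a rational square that is an integer has denominator \<open>1\<close>, and \<open>33\<close> lies strictly
  between \<open>5\<^sup>2\<close> and \<open>6\<^sup>2\<close>.
\<close>

lemma rational_square_neq_33: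
  assumes "s \<in> (\<rat> :: real set)"
  shows "s\<^sup>2 \<noteq> 33"
proof
  assume s: "s\<^sup>2 = 33"
  obtain p q :: nat where pq: "q \<noteq> 0" "\<bar>s\<bar> = of_nat p / of_nat q" "coprime p q"
    using assms by (rule Rats_abs_nat_div_natE)
  have "(of_nat p / of_nat q :: real)\<^sup>2 = 33"
    using s pq(2) by (metis power2_abs)
  then have "(of_nat (p\<^sup>2) :: real) = of_nat (33 * q\<^sup>2)"
    using pq(1) by (simp add: field_simps)
  then have eq: "p\<^sup>2 = 33 * q\<^sup>2" by (simp only: of_nat_eq_iff)
  have "coprime (p\<^sup>2) (q\<^sup>2)" using pq(3) by simp
  then have "q\<^sup>2 = 1" using eq by simp
  with eq have "p\<^sup>2 = 33" by simp
  moreover have "p \<le> 5 \<or> 6 \<le> p" by linarith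
  ultimately show False
    using power_mono[of p 5 2] power_mono[of 6 p 2] by auto
qed

text \<open>
  The cubic factors as \<open>(x + 2) (4 x\<^sup>2 + x - 2)\<close> up to the factor \<open>4\<close>; completing the square,
  \<open>16 (4 x\<^sup>2 + x - 2) = (8 x + 1)\<^sup>2 - 33\<close>.
\<close>

lemma rational_root_unique:
  assumes "x \<in> (\<rat> :: real set)" and x: "x ^ 3 + 9/4 * x\<^sup>2 = 1"
  shows "x = -2"
proof -
  have "(x + 2) * ((8 * x + 1)\<^sup>2 - 33) = 0"
    using x by (simp add: power2_eq_square power3_eq_cube algebra_simps)
  moreover have "(8 * x + 1)\<^sup>2 \<noteq> 33"
    using assms(1) by (intro rational_square_neq_33) simp
  ultimately show ?thesis by simp
qed

lemma power_mem_E_n: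
  "1 \<le> k \<Longrightarrow> k \<le> n \<Longrightarrow> (-2) ^ k \<in> E_n n"
  unfolding E_n_def by auto

lemma E_n_subset_E_all: "3 \<le> n \<Longrightarrow> E_n n \<subseteq> E_all"
  unfolding E_all_def by auto

lemma arithmetic_map_power:
  assumes f: "arithmetic_map K (E_n n) f" and "1 \<le> k" "k \<le> n"
  shows "f ((-2) ^ k) = f (-2) ^ k"
  using assms(2,3)
proof (induction k rule: dec_induct)
  case (step m)
  have "-2 \<in> E_n n" "(-2) ^ m \<in> E_n n" "(-2) * (-2) ^ m \<in> E_n n"
    using power_mem_E_n[of 1 n] power_mem_E_n[of m n] power_mem_E_n[of "Suc m" n] step by simp_all
  then have "f ((-2) * (-2) ^ m) = f (-2) * f ((-2) ^ m)"
    using f unfolding arithmetic_map_def by blast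
  then show ?case using step by simp
qed simp

text \<open>
  The bound \<open>3 \<le> n\<close> puts \<open>-8\<close> into the set, and with it the relation \<open>9 + (-8) = 1\<close> from which the
  cubic equation comes.
\<close>

lemma arithmetic_map_values:
  assumes f: "arithmetic_map K (E_n n) f" and n: "3 \<le> n"
  shows "f 9 = 9/4 * (f (-2))\<^sup>2" and "f (-2) ^ 3 + 9/4 * (f (-2))\<^sup>2 = 1"
proof -
  have mem: "1/2 \<in> E_n n" "1 \<in> E_n n" "3/2 \<in> E_n n" "9/4 \<in> E_n n" "9 \<in> E_n n"
    "4 \<in> E_n n" "-8 \<in> E_n n"
    using power_mem_E_n[of 2 n] power_mem_E_n[of 3 n] n by (simp_all add: E_n_def)
  have pow: "f 4 = (f (-2))\<^sup>2" "f (-8) = f (-2) ^ 3"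
    using arithmetic_map_power[OF f, of 2] arithmetic_map_power[OF f, of 3] n by simp_all
  have add: "f (a + b) = f a + f b" if "a \<in> E_n n" "b \<in> E_n n" "a + b \<in> E_n n" for a b
    using f that unfolding arithmetic_map_def by blast
  have mult: "f (a * b) = f a * f b" if "a \<in> E_n n" "b \<in> E_n n" "a * b \<in> E_n n" for a b
    using f that unfolding arithmetic_map_def by blast
  have one: "f 1 = 1" using f mem(2) unfolding arithmetic_map_def by blast
  have half: "f (1/2) = 1/2" using add[of "1/2" "1/2"] mem one by simp
  have three_halves: "f (3/2) = 3/2" using add[of "1/2" 1] mem one half by simp
  have "f (9/4) = 9/4" using mult[of "3/2" "3/2"] mem three_halves by simp
  then show nine: "f 9 = 9/4 * (f (-2))\<^sup>2" using mult[of "9/4" 4] mem pow by simp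
  show "f (-2) ^ 3 + 9/4 * (f (-2))\<^sup>2 = 1" using add[of 9 "-8"] mem one pow nine by simp
qed

lemma arithmetic_neighbourhood_Rats:
  assumes n: "3 \<le> n" and r: "r \<in> E_n n - {1/2, 1, 3/2, 9/4}"
  shows "arithmetic_neighbourhood \<rat> (E_n n) r"
  unfolding arithmetic_neighbourhood_def
proof (intro conjI allI impI)
  have "E_n n = {1/2, 1, 3/2, 9/4} \<union> ({9} \<union> (\<lambda>k. (-2) ^ k) ` {1..n})"
    unfolding E_n_def by auto
  then show "finite (E_n n)" by simp
  show "E_n n \<subseteq> \<rat>" using E_n_subset_E_all[OF n] E_all_subset_Rats by blast
  show "r \<in> E_n n" using r by blast
next
  fix f assume f: "arithmetic_map \<rat> (E_n n) f"
  have "-2 \<in> E_n n" using power_mem_E_n[of 1 n] n by simp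
  then have "f (-2) \<in> \<rat>" using f unfolding arithmetic_map_def by blast
  then have "f (-2) = -2" using arithmetic_map_values(2)[OF f n] by (rule rational_root_unique)
  then show "f r = r"
    using r arithmetic_map_values(1)[OF f n] arithmetic_map_power[OF f]
    by (auto simp: E_n_def)
qed

section \<open>Moving the elements over the quadratic field\<close>

theorem theorem6:
  shows "(\<exists>\<sigma>. arithmetic_map Q_sqrt33 E_all \<sigma> \<and> \<sigma> 9 \<noteq> 9 \<and>
              (\<forall>k::nat. 1 \<le> k \<longrightarrow> \<sigma> ((-2) ^ k) \<noteq> (-2) ^ k)) \<and>
         (\<forall>n::nat. 3 \<le> n \<longrightarrow> (\<forall>r \<in> E_n n - {1/2, 1, 3/2, 9/4}.
              arithmetic_neighbourhood \<rat> (E_n n) r \<and>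
              \<not> arithmetic_neighbourhood Q_sqrt33 (E_n n) r))"
proof -
  define x where "x = (sqrt 33 - 1) / 8"
  define \<sigma> where "\<sigma> = replace_neg2 x"
  have "1 < sqrt 33" "sqrt 33 < 9"
    by (simp_all add: real_less_rsqrt real_less_lsqrt)
  then have x01: "0 < x" "x < 1" by (simp_all add: x_def)
  have "4 * x\<^sup>2 + x - 2 = 0"
    by (simp add: x_def power2_eq_square field_simps)
  then have "(x + 2) * (4 * x\<^sup>2 + x - 2) = 0" by simp
  then have root: "x ^ 3 + 9/4 * x\<^sup>2 = 1"
    by (simp add: power2_eq_square power3_eq_cube algebra_simps)
  have "x = -1/8 + 1/8 * sqrt 33" by (simp add: x_def field_simps)
  moreover have "-1/8 \<in> (\<rat> :: real set)" "1/8 \<in> (\<rat> :: real set)" by simp_all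
  ultimately have "x \<in> Q_sqrt33" unfolding Q_sqrt33_eq by blast
  then have \<sigma>: "arithmetic_map Q_sqrt33 E_all \<sigma>"
    unfolding \<sigma>_def using is_subfield_Q_sqrt33 root by (intro arithmetic_map_replace_neg2)
  have "x\<^sup>2 < 1" using x01 by (simp add: power_less_one_iff)
  then have moves9: "\<sigma> 9 \<noteq> 9" by (simp add: \<sigma>_def)
  have moves: "\<sigma> ((-2) ^ k) \<noteq> (-2) ^ k" if "1 \<le> k" for k
  proof -
    have "\<bar>x ^ k\<bar> \<le> 1" using x01 by (simp add: power_abs power_le_one)
    moreover have "1 < \<bar>(-2 :: real) ^ k\<bar>" using that by (simp add: power_abs)
    ultimately show ?thesis by (auto simp: \<sigma>_def replace_neg2_power)
  qed
  have "\<not> arithmetic_neighbourhood Q_sqrt33 (E_n n) r"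
    if n: "3 \<le> n" and r: "r \<in> E_n n - {1/2, 1, 3/2, 9/4}" for n r
  proof -
    have "arithmetic_map Q_sqrt33 (E_n n) \<sigma>"
      using \<sigma> E_n_subset_E_all[OF n] by (rule arithmetic_map_subset)
    moreover have "\<sigma> r \<noteq> r" using r moves9 moves by (auto simp: E_n_def)
    ultimately show ?thesis unfolding arithmetic_neighbourhood_def by blast
  qed
  then show ?thesis using \<sigma> moves9 moves arithmetic_neighbourhood_Rats by blast
qed

end
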